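(* Let $A\in\mathbb{R}^{N\times N}$ be partitioned into blocks $A_{ij}\in\mathbb{R}^{N_i\times N_j}$, $1\le i,j\le n$, with $N=N_1+\cdots+N_n$. For $X\in\mathbb{R}^{N_n\times N_1}$ and $k=1,\ldots,n-1$ let $\mathcal{H}_k(X)$ be the submatrix consisting of block rows $k+1,\ldots,n$ and block columns $1,\ldots,k$ of the matrix obtained from $A$ by replacing the bottom-left corner block $A_{n1}$ by $X$. Then there exists $\hat X\in\mathbb{R}^{N_n\times N_1}$ such that $$\operatorname{rank}\mathcal{H}_k(\hat X)=\min_{X\in\mathbb{R}^{N_n\times N_1}}\operatorname{rank}\mathcal{H}_k(X)\qquad\text{for all } k=1,2,\ldots,n-1$$ simultaneously.
   Context: Explicitly, $\mathcal{H}_k(X)=\begin{bmatrix}A_{(k+1)1}&A_{(k+1)2}&\cdots&A_{(k+1)k}\\ \vdots&\vdots&&\vdots\\ A_{(n-1)1}&A_{(n-1)2}&\cdots&A_{(n-1)k}\\ X&A_{n2}&\cdots&A_{nk}\end{bmatrix}$; every $\mathcal{H}_k(X)$ contains the block $X$ in its bottom-left corner. *)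

theory Defs
  imports "Jordan_Normal_Form.DL_Rank_Submatrix"
begin

definition mat_rank :: "real mat \<Rightarrow> nat" where
  "mat_rank M = vec_space.rank (dim_row M) M"

text \<open>A partition is given by block sizes \<open>N 1, \<dots>, N n\<close> (the other values of \<open>N\<close> are
  irrelevant). As matrix entries are indexed from 0, block \<open>i\<close> occupies the indices
  \<open>N 1 + \<dots> + N (i - 1), \<dots>, N 1 + \<dots> + N i - 1\<close>.\<close>

definition block_end :: "(nat \<Rightarrow> nat) \<Rightarrow> nat \<Rightarrow> nat" where
  "block_end N i = (\<Sum>j=1..i. N j)"

definition block_indices :: "(nat \<Rightarrow> nat) \<Rightarrow> nat \<Rightarrow> nat set" where
  "block_indices N i = {block_end N (i - 1)..<block_end N i}"

definition replace_corner ::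
  "(nat \<Rightarrow> nat) \<Rightarrow> nat \<Rightarrow> real mat \<Rightarrow> real mat \<Rightarrow> real mat" where
  "replace_corner N n A X = mat (dim_row A) (dim_col A)
     (\<lambda>(i, j). if i \<in> block_indices N n \<and> j \<in> block_indices N 1
               then X $$ (i - block_end N (n - 1), j) else A $$ (i, j))"

definition hankel_block ::
  "(nat \<Rightarrow> nat) \<Rightarrow> nat \<Rightarrow> real mat \<Rightarrow> nat \<Rightarrow> real mat \<Rightarrow> real mat" where
  "hankel_block N n A k X = submatrix (replace_corner N n A X)
     (\<Union>i\<in>{k+1..n}. block_indices N i) (\<Union>j\<in>{1..k}. block_indices N j)"

text \<open>\<^const>\<open>Min\<close> is only meaningful on finite nonempty sets; the ranks attained by
  \<^const>\<open>hankel_block\<close> form such a set.\<close>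

lemma finite_hankel_ranks: "finite ((\<lambda>X. mat_rank (hankel_block N n A k X)) ` S)"
proof -
  have "mat_rank (hankel_block N n A k X) \<le>
      card {j. j < dim_col A \<and> j \<in> (\<Union>j\<in>{1..k}. block_indices N j)}" for X
  proof -
    let ?H = "hankel_block N n A k X"
    have "?H \<in> carrier_mat (dim_row ?H) (dim_col ?H)" by simp
    from vec_space.rank_le_nc[OF this] have "mat_rank ?H \<le> dim_col ?H"
      by (simp add: mat_rank_def)
    then show ?thesis
      by (simp add: hankel_block_def dim_submatrix replace_corner_def)
  qed
  then show ?thesis
    unfolding finite_nat_set_iff_bounded_le by blast
qed

lemma nonempty_hankel_ranks:
  "(\<lambda>X. mat_rank (hankel_block N n A k X)) ` carrier_mat p q \<noteq> {}"
  using zero_carrier_mat by blast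

end

theory Submission
  imports Defs
begin

text \<open>Split off the first block column of \<open>\<H>\<^sub>k(X)\<close>, so that its rows \<open>k + 1, \<dots>, n - 1\<close> read
  \<open>[B C]\<close> and its last block row reads \<open>[X D]\<close>. Let \<open>R\<^sub>k\<close> be the linear relation of all
  \<open>(v, w)\<close> for which some \<open>u\<close> satisfies \<open>B v + C u = 0\<close> and \<open>w + D u = 0\<close>. Since the kernel of
  \<open>\<H>\<^sub>k(X)\<close> projects onto \<open>{v. (v, X v) \<in> R\<^sub>k}\<close> with fibre the kernel of \<open>[C; D]\<close>, the rank is
  minimal as soon as \<open>(v, X v) \<in> R\<^sub>k\<close> for every \<open>v\<close> in the domain of \<open>R\<^sub>k\<close>. Passing from \<open>k\<close> to
  \<open>k + 1\<close> deletes rows of \<open>[B C]\<close> and appends columns to \<open>[C; D]\<close>, so \<open>R\<^sub>k \<subseteq> R\<^sub>k\<^sub>+\<^sub>1\<close>, and an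
  increasing chain of linear relations has a common linear selection \<open>X\<close>.\<close>

section \<open>A common linear selection for an increasing chain of relations\<close>

text \<open>Induction on \<open>m\<close>, the number of leading coordinates that may be nonzero;
  \<open>x j\<close> is the value prescribed for coordinate \<open>j\<close>. One new value serves
  the whole chain: the first relation whose domain reaches coordinate \<open>m\<close> determines
  it, and all later relations inherit the pair that was used.\<close>

lemma linear_relation_chain_selection:
  fixes R :: "nat \<Rightarrow> (nat \<Rightarrow> real) \<Rightarrow> ('b \<Rightarrow> real) \<Rightarrow> bool"
  assumes mono: "\<And>k l v w. k \<le> l \<Longrightarrow> R k v w \<Longrightarrow> R l v w"
    and lin: "\<And>k v w v' w' c. R k v w \<Longrightarrow> R k v' w' \<Longrightarrow>
      R k (\<lambda>j. v j + c * v' j) (\<lambda>i. w i + c * w' i)"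
  shows "\<exists>x. \<forall>k v w. R k v w \<longrightarrow> (\<forall>j\<ge>m. v j = 0) \<longrightarrow> R k v (\<lambda>i. \<Sum>j<m. v j * x j i)"
proof (induction m)
  case 0
  have "R k v (\<lambda>i. 0)" if "R k v w" "\<forall>j. v j = 0" for k v w
  proof -
    have "v = (\<lambda>j. 0)" using that by auto
    \<comment> \<open>Subtracting the pair \<open>(0, w)\<close> from itself leaves
      \<open>(0, 0)\<close>.\<close>
    then show ?thesis using lin[OF that(1) that(1), of "-1"] by simp
  qed
  then show ?case by (intro exI allI impI) simp
next
  case (Suc m)
  then obtain x where x: "R k v w \<Longrightarrow> \<forall>j\<ge>m. v j = 0 \<Longrightarrow> R k v (\<lambda>i. \<Sum>j<m. v j * x j i)" for k v w
    by blast
  let ?lead = "\<lambda>k v. (\<exists>w. R k v w) \<and> (\<forall>j\<ge>Suc m. v j = 0) \<and> v m \<noteq> 0"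
  show ?case
  proof (cases "\<exists>k v. ?lead k v")
    case False
    have "R k v (\<lambda>i. \<Sum>j<Suc m. v j * x j i)" if "R k v w" "\<forall>j\<ge>Suc m. v j = 0" for k v w
    proof -
      have "v m = 0" using False that by blast
      moreover from this have "\<forall>j\<ge>m. v j = 0" using that(2) by (metis le_antisym not_less_eq_eq)
      ultimately show ?thesis using x[OF that(1)] by simp
    qed
    then show ?thesis by blast
  next
    case True
    \<comment> \<open>Relations before \<open>k0\<close> never see column \<open>m\<close>; by
      monotonicity every relation from \<open>k0\<close> on contains the same pair
      \<open>(p, q)\<close>.\<close>
    define k0 where "k0 = (LEAST k. \<exists>v. ?lead k v)"
    obtain p where p: "?lead k0 p" using LeastI_ex[OF True] unfolding k0_def by blast
    then obtain q where q: "R k0 p q" by blast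
    \<comment> \<open>The new column is forced by \<open>\<Sum>j\<le>m. p j * y j = q\<close>.\<close>
    define y where "y = x(m := \<lambda>i. (q i - (\<Sum>j<m. p j * x j i)) / p m)"
    have "R k v (\<lambda>i. \<Sum>j<Suc m. v j * y j i)" if R: "R k v w" and v: "\<forall>j\<ge>Suc m. v j = 0" for k v w
    proof (cases "v m = 0")
      case True
      then have "\<forall>j\<ge>m. v j = 0" using v by (metis le_antisym not_less_eq_eq)
      then show ?thesis using x[OF R] True by (simp add: y_def)
    next
      case False
      then have "k0 \<le> k" unfolding k0_def using R v by (intro Least_le) blast
      then have Rk: "R k p q" using mono q by blast
      \<comment> \<open>Subtracting this multiple of \<open>(p, q)\<close> kills coordinate
        \<open>m\<close>, so the induction hypothesis covers the remainder; adding the multiple back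
        gives the value of \<open>y\<close>.\<close>
      let ?c = "v m / p m"
      let ?r = "\<lambda>j. v j + - ?c * p j"
      have "?r j = 0" if "j \<ge> m" for j
        using that p v by (cases "j = m") auto
      then have "R k ?r (\<lambda>i. \<Sum>j<m. ?r j * x j i)" using x lin[OF R Rk, of "- ?c"] by blast
      from lin[OF this Rk, of ?c]
      have "R k v (\<lambda>i. (\<Sum>j<m. ?r j * x j i) + ?c * q i)" by simp
      also have "(\<lambda>i. (\<Sum>j<m. ?r j * x j i) + ?c * q i) = (\<lambda>i. \<Sum>j<Suc m. v j * y j i)"
      proof
        fix i
        have "(\<Sum>j<m. ?r j * x j i) = (\<Sum>j<m. v j * x j i) - ?c * (\<Sum>j<m. p j * x j i)"
          by (simp add: sum_distrib_left sum_subtractf algebra_simps)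
        moreover have "(\<Sum>j<m. v j * y j i) = (\<Sum>j<m. v j * x j i)"
          by (simp add: y_def)
        ultimately show "(\<Sum>j<m. ?r j * x j i) + ?c * q i = (\<Sum>j<Suc m. v j * y j i)"
          using p by (simp add: y_def field_simps)
      qed
      finally show ?thesis .
    qed
    then show ?thesis by blast
  qed
qed

section \<open>Dimensions of spans, one vector at a time\<close>

context vec_space
begin

text \<open>An independent \<open>U\<close> spanning \<open>F\<close> is maximal among independent
  subsets: any further \<open>t\<close> in \<open>F\<close> lies in \<open>span U\<close> and would
  create a dependence.\<close>

lemma dim_span_eq_card:
  assumes F: "F \<subseteq> carrier_vec n" "finite F" and U: "U \<subseteq> F" "lin_indpt U" "F \<subseteq> span U"
  shows "vectorspace.dim class_ring (span_vs F) = card U"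
proof -
  have "maximal U (\<lambda>T. T \<subseteq> F \<and> lin_indpt T)"
    unfolding maximal_def
  proof (intro conjI allI impI)
    fix T assume T: "U \<subseteq> T \<and> T \<subseteq> F \<and> lin_indpt T"
    show "T = U"
    proof (rule ccontr)
      assume "T \<noteq> U"
      then obtain t where t: "t \<in> T" "t \<notin> U" using T by blast
      then have "lin_dep (insert t U)"
        using lin_dep_iff_in_span[of U t] U T F by auto
      moreover have "insert t U \<subseteq> T" using t T by blast
      ultimately show False using T subset_li_is_li by blast
    qed
  qed (use U in auto)
  then show ?thesis using dim_span F by blast
qed

text \<open>A maximal independent \<open>U\<close> in \<open>F\<close> still spans after inserting
  \<open>a\<close> from \<open>span F\<close>; otherwise \<open>insert a U\<close> is independent
  and spanning. This lets a rank be counted column by column.\<close>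

lemma dim_span_insert:
  assumes F: "F \<subseteq> carrier_vec n" "finite F" and a: "a \<in> carrier_vec n"
  shows "vectorspace.dim class_ring (span_vs (insert a F)) =
    vectorspace.dim class_ring (span_vs F) + (if a \<in> span F then 0 else 1)"
proof -
  have "lin_indpt {}" by (simp add: lin_dep_def)
  then obtain U where U: "maximal U (\<lambda>T. T \<subseteq> F \<and> lin_indpt T)"
    using maximal_exists_superset[OF F(2), of "\<lambda>T. T \<subseteq> F \<and> lin_indpt T" "{}"] by auto
  then have UF: "U \<subseteq> F" and li: "lin_indpt U" unfolding maximal_def by auto
  then have Uc: "U \<subseteq> carrier_vec n" using F by blast
  have sub: "F \<subseteq> span U"
  proof
    fix t assume t: "t \<in> F"
    show "t \<in> span U"
    proof (rule ccontr)
      assume nt: "t \<notin> span U"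
      then have "t \<notin> U" using span_mem Uc by blast
      then have "lin_indpt (U \<union> {t})" using lin_dep_iff_in_span[of U t] Uc li t F nt by auto
      then show False using U t \<open>t \<notin> U\<close> UF unfolding maximal_def by blast
    qed
  qed
  have spanF: "span F = span U"
    using span_is_subset[OF sub span_is_submodule[OF Uc]] span_is_monotone[OF UF] by (rule equalityI)
  note dF = dim_span_eq_card[OF F UF li sub]
  have ins: "insert a F \<subseteq> carrier_vec n" "finite (insert a F)" using F a by auto
  show ?thesis
  proof (cases "a \<in> span F")
    case True
    then show ?thesis
      using dF dim_span_eq_card[OF ins _ li] UF sub spanF by auto
  next
    case False
    then have aU: "a \<notin> U" "a \<notin> span U" using span_mem Uc spanF by auto
    then have li': "lin_indpt (insert a U)" using lin_dep_iff_in_span[of U a] Uc li a by auto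
    have "insert a F \<subseteq> span (insert a U)"
      using sub span_is_monotone[of U "insert a U"] span_mem[of "insert a U" a] Uc a by blast
    then have "vectorspace.dim class_ring (span_vs (insert a F)) = card (insert a U)"
      using dim_span_eq_card[OF ins _ li'] UF by blast
    then show ?thesis using aU dF False finite_subset[OF UF F(2)] by simp
  qed
qed

text \<open>Coefficients belong to indices rather than to elements of the image, so repeated columns
  cause no trouble; the passage goes through the column space of the matrix with these
  columns.\<close>

lemma in_span_image_iff:
  fixes c :: "nat \<Rightarrow> 'a vec"
  assumes c: "\<And>j. j < q \<Longrightarrow> c j \<in> carrier_vec n" and v: "v \<in> carrier_vec n"
  shows "v \<in> span (c ` {m..<q}) \<longleftrightarrow> (\<exists>x. \<forall>i<n. v $ i = (\<Sum>j=m..<q. x j * c j $ i))"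
proof -
  let ?A = "mat_of_cols n (map c [m..<q])"
  have A: "?A \<in> carrier_mat n (q - m)" by (auto simp: mat_of_cols_def)
  have "set (map c [m..<q]) \<subseteq> carrier_vec n" using c by auto
  then have "cols ?A = map c [m..<q]" by simp
  then have cs: "span (c ` {m..<q}) = col_space ?A" by (simp add: col_space_def)
  have mult: "(?A *\<^sub>v z) $ i = (\<Sum>j=m..<q. z $ (j - m) * c j $ i)"
    if "z \<in> carrier_vec (q - m)" "i < n" for z i
  proof -
    have "(?A *\<^sub>v z) $ i = (\<Sum>j=0..<q-m. c (m + j) $ i * z $ j)"
      using that by (auto simp: scalar_prod_def mat_of_cols_def intro!: sum.cong)
    also have "\<dots> = (\<Sum>j=m..<q. z $ (j - m) * c j $ i)"
      by (rule sum.reindex_bij_witness[of _ "\<lambda>j. j - m" "\<lambda>j. m + j"]) auto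
    finally show ?thesis .
  qed
  have cs_iff: "v \<in> col_space ?A \<longleftrightarrow> (\<exists>z\<in>carrier_vec (q - m). ?A *\<^sub>v z = v)"
    using v A by (simp add: col_space_eq[OF A])
  show ?thesis
  proof
    assume "v \<in> span (c ` {m..<q})"
    then obtain z where "z \<in> carrier_vec (q - m)" "?A *\<^sub>v z = v" using cs cs_iff by auto
    then show "\<exists>x. \<forall>i<n. v $ i = (\<Sum>j=m..<q. x j * c j $ i)"
      using mult by (intro exI[of _ "\<lambda>j. z $ (j - m)"]) blast
  next
    assume "\<exists>x. \<forall>i<n. v $ i = (\<Sum>j=m..<q. x j * c j $ i)"
    then obtain x where x: "\<forall>i<n. v $ i = (\<Sum>j=m..<q. x j * c j $ i)" by blast
    let ?z = "vec (q - m) (\<lambda>j. x (m + j))"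
    have "?A *\<^sub>v ?z = v"
    proof (rule eq_vecI)
      fix i assume "i < dim_vec v"
      then have i: "i < n" using v by auto
      show "(?A *\<^sub>v ?z) $ i = v $ i"
        using mult[of ?z i] i x by (auto intro!: sum.cong)
    qed (use v in auto)
    then show "v \<in> span (c ` {m..<q})" using cs cs_iff vec_carrier by metis
  qed
qed

end

section \<open>Comparing ranks through projected kernels\<close>

text \<open>Add columns from right to left: a column raises the rank exactly when it is outside the
  span of the later ones. From column \<open>p\<close> on the matrices agree. For
  \<open>m < p\<close>, \<open>ker\<close> carries a dependence of column \<open>m\<close> on later
  columns from \<open>M'\<close> to \<open>M\<close>, so \<open>M\<close> gains no more than
  \<open>M'\<close> at each step.\<close>

lemma mat_rank_le_by_kernel_projection:
  fixes M M' :: "real mat"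
  assumes M: "M \<in> carrier_mat d q" and M': "M' \<in> carrier_mat d q" and "p \<le> q"
    and eq: "\<And>i j. i < d \<Longrightarrow> p \<le> j \<Longrightarrow> j < q \<Longrightarrow> M $$ (i, j) = M' $$ (i, j)"
    and ker: "\<And>x. \<forall>i<d. (\<Sum>j<q. x j * M' $$ (i, j)) = 0 \<Longrightarrow>
      \<exists>y. (\<forall>j<p. y j = x j) \<and> (\<forall>i<d. (\<Sum>j<q. y j * M $$ (i, j)) = 0)"
  shows "mat_rank M \<le> mat_rank M'"
proof -
  interpret vec_space "TYPE(real)" d .
  let ?dim = "\<lambda>F. vectorspace.dim class_ring (span_vs F)"
  have carr: "col M j \<in> carrier_vec d" "col M' j \<in> carrier_vec d" for j
    using M M' by auto
  have rank: "mat_rank Q = ?dim (col Q ` {0..<q})" if "Q \<in> carrier_mat d q" for Q :: "real mat"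
    using that by (auto simp: mat_rank_def rank_def cols_def)
  have split: "(\<Sum>j<q. x j * Q i j) = x m * Q i m + (\<Sum>j=Suc m..<q. x j * Q i j)"
    if "\<forall>j<m. x j = 0" "m < q" for x m i and Q :: "nat \<Rightarrow> nat \<Rightarrow> real"
  proof -
    have "(\<Sum>j<q. x j * Q i j) = (\<Sum>j\<in>{m..<q}. x j * Q i j)"
      using that by (intro sum.mono_neutral_right) auto
    then show ?thesis using that by (simp add: sum.atLeast_Suc_lessThan)
  qed
  have "?dim (col M ` {m..<q}) \<le> ?dim (col M' ` {m..<q})" if "m \<le> p" for m
    using that
  proof (induction rule: inc_induct)
    case base
    have "col M ` {p..<q} = col M' ` {p..<q}"
      using M M' eq by (intro image_cong refl eq_vecI) auto
    then show ?case by simp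
  next
    case (step m)
    then have mq: "m < q" using \<open>p \<le> q\<close> by simp
    have ins: "col Q ` {m..<q} = insert (col Q m) (col Q ` {Suc m..<q})" for Q :: "real mat"
    proof -
      have "{m..<q} = insert m {Suc m..<q}" using mq by auto
      then show ?thesis by simp
    qed
    have imp: "col M m \<in> span (col M ` {Suc m..<q})" if in_span: "col M' m \<in> span (col M' ` {Suc m..<q})"
    proof -
      obtain x where x: "\<forall>i<d. col M' m $ i = (\<Sum>j=Suc m..<q. x j * col M' j $ i)"
        using in_span in_span_image_iff[of q "col M'"] carr by blast
      \<comment> \<open>The dependence becomes a kernel vector of \<open>M'\<close> with first
        nonzero entry -1 at \<open>m\<close>.\<close>
      let ?x = "\<lambda>j. if j < m then 0 else if j = m then -1 else x j"
      have "\<forall>i<d. (\<Sum>j<q. ?x j * M' $$ (i, j)) = 0"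
      proof (intro allI impI)
        fix i assume i: "i < d"
        have "(\<Sum>j<q. ?x j * M' $$ (i, j)) = - M' $$ (i, m) + (\<Sum>j=Suc m..<q. x j * M' $$ (i, j))"
          using split[of m ?x "\<lambda>i j. M' $$ (i, j)" i] mq by (auto intro!: sum.cong)
        moreover have "M' $$ (i, m) = (\<Sum>j=Suc m..<q. x j * M' $$ (i, j))"
          using x i M' mq by auto
        ultimately show "(\<Sum>j<q. ?x j * M' $$ (i, j)) = 0" by simp
      qed
      from ker[OF this] obtain y where y: "\<forall>j<p. y j = ?x j"
        and yM: "\<forall>i<d. (\<Sum>j<q. y j * M $$ (i, j)) = 0" by blast
      \<comment> \<open>Since \<open>m < p\<close>, the entries up to \<open>m\<close> survive;
        those from \<open>p\<close> on may change, but they only multiply later columns.\<close>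
      have "\<forall>j<m. y j = 0" "y m = -1" using y step by auto
      then have "\<forall>i<d. col M m $ i = (\<Sum>j=Suc m..<q. y j * col M j $ i)"
        using yM split[of m y "\<lambda>i j. M $$ (i, j)"] mq M by auto
      then show ?thesis using in_span_image_iff[of q "col M"] carr by blast
    qed
    have sub: "col M ` {Suc m..<q} \<subseteq> carrier_vec d" "col M' ` {Suc m..<q} \<subseteq> carrier_vec d"
      using carr by auto
    show ?case
      using step.IH imp unfolding ins by (simp add: dim_span_insert sub carr)
  qed
  from this[of 0] show ?thesis using rank M M' by simp
qed

section \<open>Blocks as index intervals and the entries of the Hankel blocks\<close>

lemma pick_atLeastLessThan: "i < b - a \<Longrightarrow> pick {a..<b} i = a + i"
proof (induction i)
  case 0
  then show ?case by (auto intro!: Least_equality)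
next
  case (Suc i)
  then show ?case by (auto intro!: Least_equality)
qed

lemma block_end_mono: "i \<le> j \<Longrightarrow> block_end N i \<le> block_end N j"
  unfolding block_end_def by (intro sum_mono2) auto

lemma UN_block_indices:
  "a \<le> b \<Longrightarrow> (\<Union>i\<in>{a+1..b}. block_indices N i) = {block_end N a..<block_end N b}"
proof (induction rule: dec_induct)
  case base
  then show ?case by simp
next
  case (step b)
  then have "{a+1..Suc b} = insert (Suc b) {a+1..b}" by auto
  moreover have "block_indices N (Suc b) = {block_end N b..<block_end N (Suc b)}"
    by (simp add: block_indices_def)
  ultimately show ?case
    using step block_end_mono[of a b N] block_end_mono[of b "Suc b" N] by auto
qed

text \<open>The selected block rows and block columns fill contiguous intervals, so
  \<open>pick\<close> is a shift by \<open>block_end N k\<close> on rows and the identity on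
  columns.\<close>

lemma hankel_block_eq:
  assumes A: "A \<in> carrier_mat (block_end N n) (block_end N n)" and k: "k < n"
  shows "hankel_block N n A k X = mat (block_end N n - block_end N k) (block_end N k)
    (\<lambda>(i, j). if block_end N (n - 1) \<le> block_end N k + i \<and> j < N 1
      then X $$ (block_end N k + i - block_end N (n - 1), j) else A $$ (block_end N k + i, j))"
proof -
  let ?e = "block_end N"
  have ek: "?e k \<le> ?e n" using k by (simp add: block_end_mono)
  have I: "(\<Union>i\<in>{k+1..n}. block_indices N i) = {?e k..<?e n}"
    using UN_block_indices[of k n] k by simp
  have J: "(\<Union>j\<in>{1..k}. block_indices N j) = {0..<?e k}"
    using UN_block_indices[of 0 k] by (simp add: block_end_def)
  have B1: "block_indices N (Suc 0) = {0..<N (Suc 0)}" by (simp add: block_indices_def block_end_def)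
  have Bn: "block_indices N n = {?e (n - 1)..<?e n}" by (simp add: block_indices_def)
  have ci: "{i. i < ?e n \<and> i \<in> {?e k..<?e n}} = {?e k..<?e n}"
    and cj: "{j. j < ?e n \<and> j \<in> {0..<?e k}} = {0..<?e k}" using ek by auto
  show ?thesis
    unfolding hankel_block_def I J
    by (rule eq_matI) (use A ek in \<open>auto simp: dim_submatrix submatrix_index ci[simplified] cj[simplified]
      replace_corner_def pick_atLeastLessThan B1 Bn\<close>)
qed

section \<open>Choice of the corner block and its optimality for every \<open>k\<close>\<close>

theorem theorem4p1:
  fixes n :: nat and N :: "nat \<Rightarrow> nat" and A :: "real mat"
  assumes "n \<ge> 1"
    and "A \<in> carrier_mat (\<Sum>i=1..n. N i) (\<Sum>i=1..n. N i)"
  shows "\<exists>Xhat \<in> carrier_mat (N n) (N 1). \<forall>k \<in> {1..n-1}.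
    mat_rank (hankel_block N n A k Xhat) =
      Min ((\<lambda>X. mat_rank (hankel_block N n A k X)) ` carrier_mat (N n) (N 1))"
proof -
  let ?e = "block_end N"
  have A: "A \<in> carrier_mat (?e n) (?e n)" using assms(2) by (simp add: block_end_def)
  have e1: "?e 1 = N 1" by (simp add: block_end_def)
  have en: "?e n = ?e (n - 1) + N n"
    using assms(1) by (cases n) (auto simp: block_end_def)
  \<comment> \<open>Rows and columns carry their indices in \<open>A\<close>; only \<open>w\<close>
    is indexed within the last block row. The definition covers every natural \<open>k\<close>, as
    the selection lemma requires.\<close>
  define R :: "nat \<Rightarrow> (nat \<Rightarrow> real) \<Rightarrow> (nat \<Rightarrow> real) \<Rightarrow> bool" where
    "R k v w \<longleftrightarrow> (\<exists>u. \<forall>i\<in>{?e k..<?e n}.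
      (if i < ?e (n - 1) then \<Sum>j<N 1. v j * A $$ (i, j) else w (i - ?e (n - 1)))
        + (\<Sum>j=N 1..<?e k. u j * A $$ (i, j)) = 0)" for k v w
  have mono: "R l v w" if "k \<le> l" "R k v w" for k l v w
  proof -
    have kl: "?e k \<le> ?e l" using that(1) by (rule block_end_mono)
    from that(2) obtain u where u: "\<forall>i\<in>{?e k..<?e n}.
      (if i < ?e (n - 1) then \<Sum>j<N 1. v j * A $$ (i, j) else w (i - ?e (n - 1)))
        + (\<Sum>j=N 1..<?e k. u j * A $$ (i, j)) = 0" unfolding R_def by blast
    \<comment> \<open>The old witness is extended by zero on the appended columns.\<close>
    let ?u = "\<lambda>j. if j < ?e k then u j else 0"
    have "(\<Sum>j=N 1..<?e l. ?u j * A $$ (i, j)) = (\<Sum>j=N 1..<?e k. u j * A $$ (i, j))" for i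
      using kl by (intro sum.mono_neutral_cong_right) auto
    then show ?thesis unfolding R_def using u kl by (intro exI[of _ ?u]) auto
  qed
  have lin: "R k (\<lambda>j. v j + c * v' j) (\<lambda>i. w i + c * w' i)" if vw: "R k v w" and vw': "R k v' w'"
    for k v w v' w' c
  proof -
    from vw obtain u where u: "\<forall>i\<in>{?e k..<?e n}.
      (if i < ?e (n - 1) then \<Sum>j<N 1. v j * A $$ (i, j) else w (i - ?e (n - 1)))
        + (\<Sum>j=N 1..<?e k. u j * A $$ (i, j)) = 0" unfolding R_def by blast
    from vw' obtain u' where u': "\<forall>i\<in>{?e k..<?e n}.
      (if i < ?e (n - 1) then \<Sum>j<N 1. v' j * A $$ (i, j) else w' (i - ?e (n - 1)))
        + (\<Sum>j=N 1..<?e k. u' j * A $$ (i, j)) = 0" unfolding R_def by blast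
    have comb: "(\<Sum>j\<in>J. (f j + c * g j) * A $$ (i, j)) =
      (\<Sum>j\<in>J. f j * A $$ (i, j)) + c * (\<Sum>j\<in>J. g j * A $$ (i, j))" for f g i J
      by (simp add: distrib_right sum.distrib sum_distrib_left mult.assoc)
    have add: "a + c * a' + (b + c * b') = 0" if "a + b = 0" "a' + b' = 0" for a a' b b' :: real
      using that by (simp add: add_eq_0_iff algebra_simps)
    show ?thesis unfolding R_def
    proof (intro exI[of _ "\<lambda>j. u j + c * u' j"] ballI)
      fix i assume i: "i \<in> {?e k..<?e n}"
      show "(if i < ?e (n - 1) then \<Sum>j<N 1. (v j + c * v' j) * A $$ (i, j)
          else w (i - ?e (n - 1)) + c * w' (i - ?e (n - 1)))
        + (\<Sum>j=N 1..<?e k. (u j + c * u' j) * A $$ (i, j)) = 0"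
        using add[OF bspec[OF u i] bspec[OF u' i]] by (simp add: comb split: if_splits)
    qed
  qed
  obtain x where x: "\<And>k v w. R k v w \<Longrightarrow> \<forall>j\<ge>N 1. v j = 0 \<Longrightarrow> R k v (\<lambda>i. \<Sum>j<N 1. v j * x j i)"
    using linear_relation_chain_selection[of R "N 1"] mono lin by blast
  \<comment> \<open>The value \<open>x j\<close> selected for coordinate \<open>j\<close> is column
    \<open>j\<close> of \<open>X\<close>.\<close>
  define X where "X = mat (N n) (N 1) (\<lambda>(i, j). x j i)"
  have X: "X \<in> carrier_mat (N n) (N 1)" by (simp add: X_def)
  have le: "mat_rank (hankel_block N n A k X) \<le> mat_rank (hankel_block N n A k Y)"
    if k: "k \<in> {1..n-1}" for k Y
  proof -
    have kn: "k < n" using k by auto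
    have ek: "N 1 \<le> ?e k" "?e k \<le> ?e (n - 1)"
      using k block_end_mono[of 1 k N] block_end_mono[of k "n - 1" N] e1 by auto
    note H = hankel_block_eq[OF A kn]
    have row: "(\<Sum>j<?e k. z j * hankel_block N n A k Z $$ (i - ?e k, j)) =
        (if i < ?e (n - 1) then \<Sum>j<N 1. z j * A $$ (i, j)
         else \<Sum>j<N 1. z j * Z $$ (i - ?e (n - 1), j)) + (\<Sum>j=N 1..<?e k. z j * A $$ (i, j))"
      if i: "i \<in> {?e k..<?e n}" for z Z i
    proof -
      let ?f = "\<lambda>j. z j * hankel_block N n A k Z $$ (i - ?e k, j)"
      have "sum ?f {..<?e k} = sum ?f {..<N 1} + sum ?f {N 1..<?e k}"
        using ek by (simp add: lessThan_atLeast0 sum.atLeastLessThan_concat)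
      moreover have "sum ?f {N 1..<?e k} = (\<Sum>j=N 1..<?e k. z j * A $$ (i, j))"
        using i by (intro sum.cong) (auto simp: H)
      moreover have "sum ?f {..<N 1} = (if i < ?e (n - 1) then \<Sum>j<N 1. z j * A $$ (i, j)
         else \<Sum>j<N 1. z j * Z $$ (i - ?e (n - 1), j))"
        using i ek by (auto simp: H intro!: sum.cong)
      ultimately show ?thesis by simp
    qed
    let ?d = "?e n - ?e k"
    \<comment> \<open>With \<open>v\<close> the first \<open>N 1\<close> entries of
      \<open>z\<close>, the right side says that \<open>z\<close> itself serves as the witness
      \<open>u\<close> for \<open>(v, Z v)\<close> in \<open>R k\<close>.\<close>
    have kernel: "(\<forall>i<?d. (\<Sum>j<?e k. z j * hankel_block N n A k Z $$ (i, j)) = 0) \<longleftrightarrow>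
        (\<forall>i\<in>{?e k..<?e n}. (if i < ?e (n - 1) then \<Sum>j<N 1. z j * A $$ (i, j)
         else \<Sum>j<N 1. z j * Z $$ (i - ?e (n - 1), j)) + (\<Sum>j=N 1..<?e k. z j * A $$ (i, j)) = 0)"
      for z Z
    proof -
      have "(\<forall>i<?d. P i) \<longleftrightarrow> (\<forall>i\<in>{?e k..<?e n}. P (i - ?e k))" for P
        by (metis (no_types, lifting) add.commute add_diff_cancel_left' atLeastLessThan_iff
            diff_less_mono le_add1 less_diff_conv)
      then show ?thesis using row by simp
    qed
    show ?thesis
    proof (rule mat_rank_le_by_kernel_projection[where p = "N 1"])
      show "hankel_block N n A k X \<in> carrier_mat ?d (?e k)"
        "hankel_block N n A k Y \<in> carrier_mat ?d (?e k)" by (simp_all add: H)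
      show "N 1 \<le> ?e k" by (fact ek)
      show "hankel_block N n A k X $$ (i, j) = hankel_block N n A k Y $$ (i, j)"
        if "i < ?d" "N 1 \<le> j" "j < ?e k" for i j using that by (simp add: H)
      fix z assume z: "\<forall>i<?d. (\<Sum>j<?e k. z j * hankel_block N n A k Y $$ (i, j)) = 0"
      \<comment> \<open>Truncation meets the support condition of the selection and is invisible to
        \<open>R\<close>. As \<open>(v, Y v)\<close> is in \<open>R k\<close>, so is
        \<open>(v, X v)\<close>; its witness \<open>u\<close> replaces the tail of
        \<open>z\<close>.\<close>
      let ?v = "\<lambda>j. if j < N 1 then z j else 0"
      have "R k ?v (\<lambda>i. \<Sum>j<N 1. z j * Y $$ (i, j))"
        using z unfolding kernel R_def by (intro exI[of _ z]) auto
      moreover have "(\<Sum>j<N 1. ?v j * f j) = (\<Sum>j<N 1. z j * f j)" for f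
        by simp
      ultimately obtain u where u: "\<forall>i\<in>{?e k..<?e n}.
        (if i < ?e (n - 1) then \<Sum>j<N 1. z j * A $$ (i, j) else \<Sum>j<N 1. z j * x j (i - ?e (n - 1)))
          + (\<Sum>j=N 1..<?e k. u j * A $$ (i, j)) = 0"
        using x[of k ?v] unfolding R_def by fastforce
      let ?y = "\<lambda>j. if j < N 1 then z j else u j"
      have "\<forall>i<?d. (\<Sum>j<?e k. ?y j * hankel_block N n A k X $$ (i, j)) = 0"
        unfolding kernel
      proof
        fix i assume i: "i \<in> {?e k..<?e n}"
        have "(\<Sum>j<N 1. ?y j * X $$ (i - ?e (n - 1), j)) = (\<Sum>j<N 1. z j * x j (i - ?e (n - 1)))"
          if "\<not> i < ?e (n - 1)" using that i en by (intro sum.cong) (auto simp: X_def)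
        then show "(if i < ?e (n - 1) then \<Sum>j<N 1. ?y j * A $$ (i, j)
           else \<Sum>j<N 1. ?y j * X $$ (i - ?e (n - 1), j)) + (\<Sum>j=N 1..<?e k. ?y j * A $$ (i, j)) = 0"
          using bspec[OF u i] by (cases "i < ?e (n - 1)") auto
      qed
      then show "\<exists>y. (\<forall>j<N 1. y j = z j) \<and>
          (\<forall>i<?d. (\<Sum>j<?e k. y j * hankel_block N n A k X $$ (i, j)) = 0)"
        by (intro exI[of _ ?y]) simp
    qed
  qed
  show ?thesis
    using X le finite_hankel_ranks by (intro bexI[of _ X] ballI Min_eqI[symmetric]) auto
qed

end
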